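(* For all integers $n,m\ge 1$, the butterfly graph with parameters $n,m$ is a difference graph.
   Context: A graph $G=(V,E)$ is a difference graph if there is a bijection $f$ from $V$ onto a set $S$ of positive integers such that for all distinct $x,y\in V$: $xy\in E$ if and only if $|f(x)-f(y)|\in S$. The butterfly graph with parameters $n,m$ has vertices $w_0,w_1,u_0,u_1,\dots,u_n,v_0,v_1,\dots,v_m$; its edges are: $w_0$ adjacent to every other vertex; the path edges $w_1u_0$ and $u_{i-1}u_i$ for $1\le i\le n$; and the path edges $v_{j-1}v_j$ for $1\le j\le m$. (Equivalently, two fans with a common apex $w_0$, one over the path $w_1u_0u_1\cdots u_n$ and one over the path $v_0v_1\cdots v_m$.) *)

theory Defs
  imports "Graph_Theory.Graph_Theory"
begin

text \<open>Finite simple graphs are \<^locale>\<open>pair_graph\<close>s: an undirected edge is a pair of opposite arcs.\<close>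

definition difference_graph :: "'a pair_pre_digraph \<Rightarrow> bool" where
  "difference_graph G \<longleftrightarrow>
     pair_graph G \<and>
     (\<exists>(S :: int set) f. S \<subseteq> {0<..} \<and> bij_betw f (pverts G) S \<and>
        (\<forall>x\<in>pverts G. \<forall>y\<in>pverts G. x \<noteq> y \<longrightarrow>
           ((x, y) \<in> parcs G \<longleftrightarrow> \<bar>f x - f y\<bar> \<in> S)))"

datatype butterfly_vertex = W nat | U nat | V nat

definition butterfly_verts :: "nat \<Rightarrow> nat \<Rightarrow> butterfly_vertex set" where
  "butterfly_verts n m = {W 0, W 1} \<union> {U i | i. i \<le> n} \<union> {V j | j. j \<le> m}"

text \<open>Each undirected edge is listed in one direction only.\<close>

definition butterfly_edges :: "nat \<Rightarrow> nat \<Rightarrow> butterfly_vertex rel" where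
  "butterfly_edges n m =
     {(W 0, x) | x. x \<in> butterfly_verts n m - {W 0}}
     \<union> {(W 1, U 0)}
     \<union> {(U (i - 1), U i) | i. 1 \<le> i \<and> i \<le> n}
     \<union> {(V (j - 1), V j) | j. 1 \<le> j \<and> j \<le> m}"

definition butterfly :: "nat \<Rightarrow> nat \<Rightarrow> butterfly_vertex pair_pre_digraph" where
  "butterfly n m =
     \<lparr> pverts = butterfly_verts n m, parcs = butterfly_edges n m \<union> (butterfly_edges n m)\<inverse> \<rparr>"

lemma pair_graph_butterfly: "pair_graph (butterfly n m)"
proof -
  let ?V = "butterfly_verts n m" and ?E = "butterfly_edges n m"
  have fin: "finite ?V"
    by (simp add: butterfly_verts_def)
  have sub: "?E \<subseteq> ?V \<times> ?V"
    by (auto simp: butterfly_edges_def butterfly_verts_def)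
  have loopfree: "fst e \<noteq> snd e" if "e \<in> ?E" for e
    using that by (auto simp: butterfly_edges_def)
  have finE: "finite ?E"
    using fin sub by (meson finite_SigmaI finite_subset)
  show ?thesis
  proof
    show "finite (pverts (butterfly n m))" "finite (parcs (butterfly n m))"
      using fin finE by (simp_all add: butterfly_def)
    show "symmetric (with_proj (butterfly n m))"
      by (simp add: butterfly_def symmetric_def sym_Un_converse)
  next
    fix e assume "e \<in> parcs (butterfly n m)"
    then have e: "e \<in> ?E \<union> ?E\<inverse>" by (simp add: butterfly_def)
    show "fst e \<in> pverts (butterfly n m)" "snd e \<in> pverts (butterfly n m)"
      using e sub by (auto simp: butterfly_def)
    show "fst e \<noteq> snd e"
      using e loopfree by fastforce
  qed
qed

end

theory Submission
  imports Defs
begin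

text \<open>
  Label the apex with 5, the path \<open>w\<^sub>1, u\<^sub>0, \<dots>, u\<^sub>n\<close> with \<open>1, 6, 11, \<dots>\<close> and the other path with
  \<open>4, 9, 14, \<dots>\<close>. Differences along one path are multiples of 5, and 5 is the only such label;
  differences between the paths are 2 or 3 modulo 5, which no label is. Subtracting
  the apex label moves one step down either path, and from its first vertex to that of the
  other path, because \<open>5 - 1 = 4\<close>.
\<close>

fun butterfly_label :: "butterfly_vertex \<Rightarrow> int" where
  "butterfly_label (W k) = (if k = 0 then 5 else 1)"
| "butterfly_label (U i) = 5 * int i + 6"
| "butterfly_label (V j) = 5 * int j + 4"

text \<open>Given by residues and bounds instead of as an image, so that membership of a difference
  is plain arithmetic. The label 1 of \<open>W 1\<close> falls into the class of the
  \<open>U\<close> labels.\<close>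

definition butterfly_labels :: "nat \<Rightarrow> nat \<Rightarrow> int set" where
  "butterfly_labels n m =
     {s. s = 5 \<or> (s mod 5 = 1 \<and> 1 \<le> s \<and> s \<le> 5 * int n + 6)
             \<or> (s mod 5 = 4 \<and> 4 \<le> s \<and> s \<le> 5 * int m + 4)}"

lemma butterfly_verts_cases:
  assumes "x \<in> butterfly_verts n m"
  obtains "x = W 0" | "x = W 1" | i where "x = U i" "i \<le> n" | j where "x = V j" "j \<le> m"
  using assms by (auto simp: butterfly_verts_def)

lemma inj_on_butterfly_label: "inj_on butterfly_label (butterfly_verts n m)"
proof (rule inj_onI)
  fix x y
  assume "x \<in> butterfly_verts n m" "y \<in> butterfly_verts n m"
    and "butterfly_label x = butterfly_label y"
  then show "x = y"
    by (elim butterfly_verts_cases) (simp_all; presburger)+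
qed

lemma butterfly_label_image:
  "butterfly_label ` butterfly_verts n m = butterfly_labels n m"
proof (intro equalityI subsetI)
  fix s assume "s \<in> butterfly_label ` butterfly_verts n m"
  then obtain x where "x \<in> butterfly_verts n m" "s = butterfly_label x"
    by blast
  then show "s \<in> butterfly_labels n m"
    by (elim butterfly_verts_cases) (simp_all add: butterfly_labels_def; presburger)+
next
  fix s assume "s \<in> butterfly_labels n m"
  \<comment> \<open>Separates \<open>W 1\<close> from the \<open>U\<close> vertices, which share its
    residue but start at 6.\<close>
  moreover have "s = 1" if "s mod 5 = 1" "1 \<le> s" "\<not> 6 \<le> s"
    using that by presburger
  ultimately consider "s = 5" | "s = 1" | "s mod 5 = 1" "6 \<le> s" "s \<le> 5 * int n + 6"
    | "s mod 5 = 4" "4 \<le> s" "s \<le> 5 * int m + 4"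
    unfolding butterfly_labels_def by blast
  then show "s \<in> butterfly_label ` butterfly_verts n m"
  proof cases
    case 1
    then show ?thesis
      by (intro image_eqI[of _ _ "W 0"]) (simp_all add: butterfly_verts_def)
  next
    case 2
    then show ?thesis
      by (intro image_eqI[of _ _ "W 1"]) (simp_all add: butterfly_verts_def)
  next
    case 3
    \<comment> \<open>Since \<open>5 * i + 6\<close> has quotient \<open>i + 1\<close> by 5, the
      index is one less than the quotient; \<open>6 \<le> s\<close> keeps it nonnegative.\<close>
    then have "s = butterfly_label (U (nat (s div 5 - 1)))" "nat (s div 5 - 1) \<le> n"
      by (simp_all; presburger)+
    then show ?thesis
      by (intro image_eqI[of _ _ "U (nat (s div 5 - 1))"]) (simp_all add: butterfly_verts_def)
  next
    case 4
    then have "s = butterfly_label (V (nat (s div 5)))" "nat (s div 5) \<le> m"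
      by (simp_all; presburger)+
    then show ?thesis
      by (intro image_eqI[of _ _ "V (nat (s div 5))"]) (simp_all add: butterfly_verts_def)
  qed
qed

text \<open>Negation swaps the residues 2 and 3 modulo 5, while labels have residue 0, 1 or
  4.\<close>

lemma abs_notin_butterfly_labels:
  assumes "z mod 5 = 2 \<or> z mod 5 = 3"
  shows "\<bar>z\<bar> \<notin> butterfly_labels n m"
proof -
  have "\<bar>z\<bar> mod 5 = 2 \<or> \<bar>z\<bar> mod 5 = 3"
    using assms by (cases "0 \<le> z") (simp, simp, presburger)
  then show ?thesis
    by (auto simp: butterfly_labels_def)
qed

lemma multiple_in_butterfly_labels_iff:
  "\<bar>5 * int i - 5 * int j\<bar> \<in> butterfly_labels n m \<longleftrightarrow> i = Suc j \<or> j = Suc i"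
proof -
  have "\<bar>5 * int i - 5 * int j\<bar> = 5 * \<bar>int i - int j\<bar>"
    by (simp add: abs_if)
  then have "\<bar>5 * int i - 5 * int j\<bar> \<in> butterfly_labels n m \<longleftrightarrow> \<bar>int i - int j\<bar> = 1"
    by (simp add: butterfly_labels_def)
  then show ?thesis
    by linarith
qed

text \<open>This is the distance from the apex label 5 to the label of \<open>V j\<close>: it is the
  label of \<open>V (j - 1)\<close>, or that of \<open>W 1\<close> if \<open>j = 0\<close>.\<close>

lemma apex_in_butterfly_labels:
  assumes "j \<le> m"
  shows "\<bar>5 * int j - 1\<bar> \<in> butterfly_labels n m"
proof (cases j)
  case (Suc k)
  then have "\<bar>5 * int j - 1\<bar> = 5 * int k + 4"
    by simp
  then show ?thesis
    using assms Suc by (simp add: butterfly_labels_def)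
qed (simp add: butterfly_labels_def)

lemma butterfly_arcs_iff_label:
  assumes "x \<in> butterfly_verts n m" "y \<in> butterfly_verts n m" "x \<noteq> y"
  shows "(x, y) \<in> parcs (butterfly n m) \<longleftrightarrow>
    \<bar>butterfly_label x - butterfly_label y\<bar> \<in> butterfly_labels n m"
proof -
  \<comment> \<open>The differences appear in the form into which the simplifier rewrites them.\<close>
  have cross: "\<bar>2 + (5 * int i - 5 * int j)\<bar> \<notin> butterfly_labels n m"
    "\<bar>5 * int j - 5 * int i - 2\<bar> \<notin> butterfly_labels n m" for i j
    by (rule abs_notin_butterfly_labels, presburger)+
  have apex: "\<bar>1 - 5 * int j\<bar> \<in> butterfly_labels n m" if "j \<le> m" for j
    using apex_in_butterfly_labels[OF that] by (simp add: abs_minus_commute)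
  \<comment> \<open>The difference between \<open>V j\<close> and \<open>W 1\<close>, whose label is
    1.\<close>
  have start: "5 * int j + 3 \<notin> butterfly_labels n m" "3 + 5 * int j \<notin> butterfly_labels n m" for j
    using abs_notin_butterfly_labels[of "5 * int j + 3" n m] by (simp_all add: add.commute)
  \<comment> \<open>Pairs among \<open>W 0\<close>, \<open>W 1\<close> and \<open>U i\<close> of
    different kinds have no prepared fact; unfolding \<open>butterfly_labels\<close> settles
    them.\<close>
  have "(x, y) \<in> butterfly_edges n m \<or> (y, x) \<in> butterfly_edges n m \<longleftrightarrow>
    \<bar>butterfly_label x - butterfly_label y\<bar> \<in> butterfly_labels n m"
    using assms
    by (elim butterfly_verts_cases)
      (simp_all add: butterfly_edges_def butterfly_verts_def cross apex start
          apex_in_butterfly_labels multiple_in_butterfly_labels_iff,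
        auto simp: butterfly_labels_def)
  then show ?thesis
    by (simp add: butterfly_def)
qed

theorem theorem3p3:
  fixes n m :: nat
  assumes "n \<ge> 1" and "m \<ge> 1"
  shows "difference_graph (butterfly n m)"
proof -
  have "butterfly_labels n m \<subseteq> {0<..}"
    by (auto simp: butterfly_labels_def)
  moreover have "bij_betw butterfly_label (pverts (butterfly n m)) (butterfly_labels n m)"
    by (simp add: bij_betw_def butterfly_def inj_on_butterfly_label butterfly_label_image)
  moreover have "\<forall>x\<in>pverts (butterfly n m). \<forall>y\<in>pverts (butterfly n m). x \<noteq> y \<longrightarrow>
      ((x, y) \<in> parcs (butterfly n m) \<longleftrightarrow>
       \<bar>butterfly_label x - butterfly_label y\<bar> \<in> butterfly_labels n m)"
    using butterfly_arcs_iff_label by (simp add: butterfly_def)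
  ultimately show ?thesis
    unfolding difference_graph_def using pair_graph_butterfly by blast
qed

end
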